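(* Let $m\ge2$ be an integer and $d_2'=\gcd(2,m)$. Then $$[\mathrm{O}(2)^-]\circledcirc[\mathbb{Z}_m\oplus\mathbb{Z}_2^c]=\{[\mathbb{1}],[\mathbb{Z}_m],[\mathbb{Z}_{d_2'}^-]\},$$ where $[\mathbb{Z}_1^-]$ is understood as $[\mathbb{1}]$.
   Context: $[K]$ is the conjugacy class of a subgroup $K$ in $\mathrm{O}(3)$, and the clips operation is $[H_1]\circledcirc[H_2]=\{[H_1\cap gH_2g^{-1}]:g\in\mathrm{O}(3)\}$. $(e_1,e_2,e_3)$ is the canonical basis of $\mathbb{R}^3$, $\mathbf{r}(n,\theta)$ is the rotation by angle $\theta$ about the axis directed by $n\neq0$. $\mathbb{1}=\{\mathrm{Id}\}$; $\mathbb{Z}_2^c=\{\pm\mathrm{Id}\}$; $H\oplus\mathbb{Z}_2^c=H\cup(-H)$ for $H\subset\mathrm{SO}(3)$; $\mathbb{Z}_k=\{\mathbf{r}(e_3,2j\pi/k):0\le j\le k-1\}$; $\mathbb{Z}_2^-=\{\mathrm{Id},-\mathbf{r}(e_3,\pi)\}$; $\mathrm{SO}(2)=\{\mathbf{r}(e_3,\theta):\theta\in[0,2\pi]\}$; $\mathrm{O}(2)^-=\mathrm{SO}(2)\cup(-\mathbf{r}(e_1,\pi))\mathrm{SO}(2)$. *)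

theory Defs
  imports "HOL-Analysis.Analysis"
begin

definition O3 :: "(real^3^3) set" where
  "O3 = {g. orthogonal_matrix g}"

definition conj_by :: "real^3^3 \<Rightarrow> (real^3^3) set \<Rightarrow> (real^3^3) set" where
  "conj_by g H = (\<lambda>h. g ** h ** matrix_inv g) ` H"

definition conj_class :: "(real^3^3) set \<Rightarrow> (real^3^3) set set" where
  "conj_class K = {conj_by g K | g. g \<in> O3}"

text \<open>The clips operation acts on conjugacy classes, so the definition ranges over all
  representatives; the lemma \<open>clips_conj_class\<close> below shows that a single pair of
  representatives suffices, which is the usual defining formula.\<close>

definition clips ::
  "(real^3^3) set set \<Rightarrow> (real^3^3) set set \<Rightarrow> (real^3^3) set set set" (infixl "\<circledcirc>" 70) where
  "C1 \<circledcirc> C2 = {conj_class (H1 \<inter> conj_by g H2) | H1 H2 g. H1 \<in> C1 \<and> H2 \<in> C2 \<and> g \<in> O3}"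

text \<open>Rodrigues' formula for the rotation by angle \<open>\<theta>\<close> about the axis directed by
  \<open>n \<noteq> 0\<close>; \<open>sgn n\<close> is the unit vector \<open>n / norm n\<close>.\<close>

definition rot :: "real^3 \<Rightarrow> real \<Rightarrow> real^3^3" where
  "rot n \<theta> = matrix (\<lambda>v. cos \<theta> *\<^sub>R v + sin \<theta> *\<^sub>R cross3 (sgn n) v
                        + ((1 - cos \<theta>) * (sgn n \<bullet> v)) *\<^sub>R sgn n)"

abbreviation e1 :: "real^3" where "e1 \<equiv> axis 1 1"
abbreviation e3 :: "real^3" where "e3 \<equiv> axis 3 1"

definition trivial_grp :: "(real^3^3) set" where
  "trivial_grp = {mat 1}"

definition Z_grp :: "nat \<Rightarrow> (real^3^3) set" where
  "Z_grp k = {rot e3 (2 * real j * pi / real k) | j. j < k}"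

definition plus_Z2c :: "(real^3^3) set \<Rightarrow> (real^3^3) set" where
  "plus_Z2c H = H \<union> uminus ` H"

definition Z2_minus :: "(real^3^3) set" where
  "Z2_minus = {mat 1, - rot e3 pi}"

text \<open>Only the indices 1 and 2 are used; index 1 is a convention.\<close>

definition Z_minus :: "nat \<Rightarrow> (real^3^3) set" where
  "Z_minus d = (if d = 1 then trivial_grp else if d = 2 then Z2_minus else undefined)"

definition SO2 :: "(real^3^3) set" where
  "SO2 = {rot e3 \<theta> | \<theta>. \<theta> \<in> {0..2 * pi}}"

definition O2_minus :: "(real^3^3) set" where
  "O2_minus = SO2 \<union> (\<lambda>A. (- rot e1 pi) ** A) ` SO2"

lemma matrix_inv_O3:
  assumes "g \<in> O3"
  shows "matrix_inv g = transpose g"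
proof -
  have "\<exists>h. g ** h = mat 1 \<and> h ** g = mat 1"
    using assms by (auto simp: O3_def orthogonal_matrix_def)
  then have "g ** matrix_inv g = mat 1"
    unfolding matrix_inv_def by (rule someI2_ex) simp
  then have "transpose g ** (g ** matrix_inv g) = transpose g"
    by simp
  moreover have "transpose g ** g = mat 1"
    using assms by (simp add: O3_def orthogonal_matrix_def)
  ultimately show ?thesis
    by (simp add: matrix_mul_assoc)
qed

lemma O3_closed: "g \<in> O3 \<Longrightarrow> h \<in> O3 \<Longrightarrow> g ** h \<in> O3" "mat 1 \<in> O3"
  "g \<in> O3 \<Longrightarrow> transpose g \<in> O3"
  by (auto simp: O3_def orthogonal_matrix_mul orthogonal_matrix_id)

lemma conj_by_mult:
  assumes "g \<in> O3" "h \<in> O3"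
  shows "conj_by g (conj_by h K) = conj_by (g ** h) K"
  using assms O3_closed(1)[OF assms]
  by (simp add: conj_by_def image_image matrix_inv_O3 matrix_transpose_mul matrix_mul_assoc)

lemma conj_by_one: "conj_by (mat 1) K = K"
  by (simp add: conj_by_def matrix_inv_O3 O3_closed)

lemma transpose_O3: "g \<in> O3 \<Longrightarrow> transpose g ** g = mat 1" "g \<in> O3 \<Longrightarrow> g ** transpose g = mat 1"
  by (auto simp: O3_def orthogonal_matrix_def)

lemma conj_by_Int:
  assumes "g \<in> O3"
  shows "conj_by g (A \<inter> B) = conj_by g A \<inter> conj_by g B"
proof -
  have "transpose g ** (g ** h ** matrix_inv g) ** g = h" for h
  proof -
    have "transpose g ** (g ** h ** transpose g) ** g
        = (transpose g ** g) ** h ** (transpose g ** g)"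
      by (simp only: matrix_mul_assoc)
    then show ?thesis
      by (simp add: assms matrix_inv_O3 transpose_O3)
  qed
  then have "inj (\<lambda>h. g ** h ** matrix_inv g)"
    by (rule inj_on_inverseI)
  then show ?thesis
    by (simp add: conj_by_def image_Int)
qed

lemma conj_class_conj_by:
  assumes "g \<in> O3"
  shows "conj_class (conj_by g K) = conj_class K"
proof
  show "conj_class (conj_by g K) \<subseteq> conj_class K"
    using assms by (auto simp: conj_class_def conj_by_mult intro: O3_closed)
  have "conj_by h K = conj_by (h ** transpose g) (conj_by g K)" if "h \<in> O3" for h
    using assms that
    by (simp add: conj_by_mult O3_closed matrix_mul_assoc[symmetric] transpose_O3)
  then show "conj_class K \<subseteq> conj_class (conj_by g K)"
    using assms unfolding conj_class_def by (blast intro: O3_closed)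
qed

lemma clips_conj_class:
  "conj_class H1 \<circledcirc> conj_class H2 = {conj_class (H1 \<inter> conj_by g H2) | g. g \<in> O3}"
proof
  have "K \<in> conj_class K" for K
    unfolding conj_class_def using O3_closed(2) conj_by_one[of K, symmetric] by blast
  then show "{conj_class (H1 \<inter> conj_by g H2) | g. g \<in> O3} \<subseteq> conj_class H1 \<circledcirc> conj_class H2"
    unfolding clips_def by blast
  have "\<exists>g'\<in>O3. conj_class (conj_by a H1 \<inter> conj_by g (conj_by b H2))
          = conj_class (H1 \<inter> conj_by g' H2)" if "a \<in> O3" "b \<in> O3" "g \<in> O3" for a b g
  proof
    let ?g' = "transpose a ** g ** b"
    show g': "?g' \<in> O3" using that by (intro O3_closed)
    have "conj_by a (conj_by ?g' H2) = conj_by g (conj_by b H2)"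
      using that g' by (simp add: conj_by_mult O3_closed matrix_mul_assoc transpose_O3)
    then have "conj_by a H1 \<inter> conj_by g (conj_by b H2) = conj_by a (H1 \<inter> conj_by ?g' H2)"
      using that by (simp add: conj_by_Int)
    then show "conj_class (conj_by a H1 \<inter> conj_by g (conj_by b H2))
          = conj_class (H1 \<inter> conj_by ?g' H2)"
      using that by (simp add: conj_class_conj_by)
  qed
  then show "conj_class H1 \<circledcirc> conj_class H2 \<subseteq> {conj_class (H1 \<inter> conj_by g H2) | g. g \<in> O3}"
    unfolding clips_def conj_class_def[of H1] conj_class_def[of H2] by blast
qed

end

theory Submission
  imports Defs
begin

text \<open>The group \<open>O2_minus\<close> consists of exactly those orthogonal matrices that fix the vector \<open>e3\<close>
  (\<open>O2_minus_eq_fix_e3\<close>).  Hence, up to conjugation by \<open>g\<close>, its intersection with \<open>g H g\<inverse>\<close> is the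
  stabilizer in \<open>H\<close> of the unit vector \<open>g\<inverse> e3\<close>, and since \<open>O(3)\<close> acts transitively on the unit
  sphere, the clips operation with \<open>O2_minus\<close> lists the classes of all stabilizers in \<open>H\<close> of points
  of the sphere (\<open>clips_O2_minus\<close>).

  For \<open>H = \<int>\<^sub>m \<oplus> \<int>\<^sub>2\<^sup>c\<close>, whose elements are \<open>\<plusminus>r(e3, 2j\<pi>/m)\<close>, the stabilizer depends only on
  the position of the point.  A pole is fixed by all rotations in \<open>H\<close> and by none of their negatives,
  which exchange the poles; this gives \<open>\<int>\<^sub>m\<close>.  A point off the axis is fixed by no rotation but the
  identity, and \<open>-r(e3, \<theta>)\<close> can fix it only if it lies on the equator, because the third coordinate
  changes sign, and then only for \<open>\<theta> = \<pi>\<close>.  The angle \<open>\<pi>\<close> occurs in \<open>H\<close> precisely for even \<open>m\<close>.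
  So an equatorial point gives \<open>\<int>\<^sub>2\<^sup>-\<close> or the trivial group according to the parity of \<open>m\<close>, and any
  other point gives the trivial group.\<close>

section \<open>Rotations about the vertical axis\<close>

lemma rot_e3_mult_vec:
  "(rot e3 t *v v) $ 1 = cos t * v $ 1 - sin t * v $ 2"
  "(rot e3 t *v v) $ 2 = sin t * v $ 1 + cos t * v $ 2"
  "(rot e3 t *v v) $ 3 = v $ 3"
  by (simp_all add: rot_def matrix_def matrix_vector_mult_def sum_3 cross3_simps axis_def sgn_div_norm
      norm_vec_def L2_set_def inner_vec_def)

lemma rot_e3_entries:
  "rot e3 t $ 1 $ 1 = cos t" "rot e3 t $ 1 $ 2 = - sin t" "rot e3 t $ 1 $ 3 = 0"
  "rot e3 t $ 2 $ 1 = sin t" "rot e3 t $ 2 $ 2 = cos t" "rot e3 t $ 2 $ 3 = 0"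
  "rot e3 t $ 3 $ 1 = 0" "rot e3 t $ 3 $ 2 = 0" "rot e3 t $ 3 $ 3 = 1"
  by (simp_all add: rot_def matrix_def sum_3 cross3_simps axis_def sgn_div_norm
      norm_vec_def L2_set_def inner_vec_def)

lemma rot_e1_pi_entries:
  "rot e1 pi $ 1 $ 1 = 1" "rot e1 pi $ 1 $ 2 = 0" "rot e1 pi $ 1 $ 3 = 0"
  "rot e1 pi $ 2 $ 1 = 0" "rot e1 pi $ 2 $ 2 = -1" "rot e1 pi $ 2 $ 3 = 0"
  "rot e1 pi $ 3 $ 1 = 0" "rot e1 pi $ 3 $ 2 = 0" "rot e1 pi $ 3 $ 3 = -1"
  by (simp_all add: rot_def matrix_def sum_3 cross3_simps axis_def sgn_div_norm
      norm_vec_def L2_set_def inner_vec_def)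

lemma rot_e3_0: "rot e3 0 = mat 1"
  by (simp add: vec_eq_iff forall_3 rot_e3_entries mat_def)

lemma rot_e3_in_O3: "rot e3 t \<in> O3"
  by (simp add: O3_def orthogonal_matrix vec_eq_iff forall_3 rot_e3_entries mat_def
      matrix_matrix_mult_def transpose_def sum_3 power2_eq_square[symmetric])

lemma uminus_in_O3: "A \<in> O3 \<Longrightarrow> - A \<in> O3"
  by (simp add: O3_def orthogonal_matrix vec_eq_iff matrix_matrix_mult_def transpose_def)

lemma rot_e1_pi_in_O3: "rot e1 pi \<in> O3"
  by (simp add: O3_def orthogonal_matrix vec_eq_iff forall_3 rot_e1_pi_entries mat_def
      matrix_matrix_mult_def transpose_def sum_3)

lemma plus_Z2c_Z_grp_subset_O3: "plus_Z2c (Z_grp m) \<subseteq> O3"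
  by (auto simp: plus_Z2c_def Z_grp_def rot_e3_in_O3 uminus_in_O3)

lemma matrix_vector_mult_uminus: "(- A) *v v = - (A *v (v :: real^3))"
  by (simp add: vec_eq_iff matrix_vector_mult_def sum_negf)

section \<open>Intersections with \<open>O2_minus\<close> as stabilizers\<close>

text \<open>An orthogonal matrix fixing \<open>e3\<close> has both third column and third row \<open>e3\<close>, so it is an
  orthogonal \<open>2 \<times> 2\<close> block.  Its first column is a unit vector and therefore determines the angle; the
  second column is one of the two unit vectors orthogonal to the first, and the choice decides
  between a rotation and a reflection in a vertical plane.\<close>

lemma O2_minus_eq_fix_e3: "O2_minus = {A \<in> O3. A *v e3 = e3}"
proof (intro subset_antisym subsetI)
  fix A assume "A \<in> O2_minus"
  then obtain t where t: "A = rot e3 t \<or> A = (- rot e1 pi) ** rot e3 t"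
    by (auto simp: O2_minus_def SO2_def)
  have "rot e3 t *v e3 = e3"
    by (simp only: vec_eq_iff forall_3 rot_e3_mult_vec) (simp add: axis_def)
  moreover have "(- rot e1 pi) *v e3 = e3"
    by (simp add: vec_eq_iff forall_3 matrix_vector_mult_def sum_3 rot_e1_pi_entries axis_def[of 3])
  ultimately show "A \<in> {A \<in> O3. A *v e3 = e3}"
    using t by (auto simp: rot_e3_in_O3 rot_e1_pi_in_O3 uminus_in_O3 O3_closed
        matrix_vector_mul_assoc[symmetric])
next
  fix A assume "A \<in> {A \<in> O3. A *v e3 = e3}"
  then have A: "A \<in> O3" and fix_e3: "A *v e3 = e3" by auto
  have "transpose A *v e3 = (transpose A ** A) *v e3"
    by (simp add: fix_e3 matrix_vector_mul_assoc[symmetric])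
  then have fix_e3': "transpose A *v e3 = e3"
    by (simp add: transpose_O3(1)[OF A])
  have col3: "A $ 1 $ 3 = 0" "A $ 2 $ 3 = 0" "A $ 3 $ 3 = 1"
    using fix_e3 by (simp_all add: vec_eq_iff forall_3 matrix_vector_mult_def sum_3 axis_def)
  have row3: "A $ 3 $ 1 = 0" "A $ 3 $ 2 = 0"
    using fix_e3' by (simp_all add: vec_eq_iff forall_3 matrix_vector_mult_def sum_3 axis_def transpose_def)
  define a b c d where "a = A $ 1 $ 1" and "b = A $ 1 $ 2" and "c = A $ 2 $ 1" and "d = A $ 2 $ 2"
  have "transpose A ** A = mat 1" by (rule transpose_O3(1)[OF A])
  then have ac: "a\<^sup>2 + c\<^sup>2 = 1" and orth: "a * b + c * d = 0" and bd: "b\<^sup>2 + d\<^sup>2 = 1"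
    by (simp_all add: vec_eq_iff forall_3 matrix_matrix_mult_def transpose_def sum_3 mat_def
        col3 row3 a_def b_def c_def d_def power2_eq_square)
  \<comment> \<open>The determinant \<open>e = \<plusminus>1\<close> of the block tells rotations from reflections.\<close>
  define e where "e = a * d - b * c"
  have "b = - c * e \<and> d = a * e"
    using ac orth unfolding e_def by algebra
  moreover have "e\<^sup>2 = 1"
    using ac orth bd unfolding e_def by algebra
  then have "e = 1 \<or> e = -1" by (simp add: power2_eq_1_iff)
  ultimately consider "b = - c" "d = a" | "b = c" "d = - a" by fastforce
  then show "A \<in> O2_minus"
  proof cases
    case 1
    obtain t where "0 \<le> t" "t \<le> 2 * pi" "a = cos t" "c = sin t"
      using sincos_total_2pi_le[OF ac] by auto
    then have "A = rot e3 t"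
      using 1 col3 row3 a_def b_def c_def d_def
      by (simp add: vec_eq_iff forall_3 rot_e3_entries)
    with \<open>0 \<le> t\<close> \<open>t \<le> 2 * pi\<close> show ?thesis
      by (auto simp: O2_minus_def SO2_def)
  next
    case 2
    \<comment> \<open>The factor \<open>-r(e1, \<pi>)\<close> negates the first row, hence the sign of \<open>a\<close>.\<close>
    have "(- a)\<^sup>2 + c\<^sup>2 = 1" using ac by simp
    then obtain t where "0 \<le> t" "t \<le> 2 * pi" "- a = cos t" "c = sin t"
      using sincos_total_2pi_le by blast
    then have "A = (- rot e1 pi) ** rot e3 t"
      using 2 col3 row3 a_def b_def c_def d_def
      by (simp add: vec_eq_iff forall_3 rot_e3_entries rot_e1_pi_entries matrix_matrix_mult_def sum_3)
    with \<open>0 \<le> t\<close> \<open>t \<le> 2 * pi\<close> show ?thesis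
      by (auto simp: O2_minus_def SO2_def)
  qed
qed

definition stabilizer :: "(real^3^3) set \<Rightarrow> real^3 \<Rightarrow> (real^3^3) set" where
  "stabilizer H v = {h \<in> H. h *v v = v}"

lemma O2_minus_Int_conj_by:
  assumes g: "g \<in> O3" and H: "H \<subseteq> O3"
  shows "O2_minus \<inter> conj_by g H = conj_by g (stabilizer H (transpose g *v e3))"
proof -
  have "(g ** h ** transpose g) *v e3 = e3 \<longleftrightarrow> h *v (transpose g *v e3) = transpose g *v e3" for h
  proof
    assume "(g ** h ** transpose g) *v e3 = e3"
    then have "transpose g *v ((g ** h ** transpose g) *v e3) = transpose g *v e3" by simp
    then show "h *v (transpose g *v e3) = transpose g *v e3"
      by (simp add: matrix_vector_mul_assoc matrix_mul_assoc transpose_O3(1)[OF g] del: transpose_matrix_vector)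
  next
    assume "h *v (transpose g *v e3) = transpose g *v e3"
    then have "g *v (h *v (transpose g *v e3)) = g *v (transpose g *v e3)" by simp
    then show "(g ** h ** transpose g) *v e3 = e3"
      by (simp add: matrix_vector_mul_assoc matrix_mul_assoc transpose_O3(2)[OF g] del: transpose_matrix_vector)
  qed
  moreover have "g ** h ** transpose g \<in> O3" if "h \<in> H" for h
    using that g H by (auto intro!: O3_closed)
  ultimately show ?thesis
    using g by (auto simp: O2_minus_eq_fix_e3 conj_by_def stabilizer_def matrix_inv_O3)
qed

text \<open>Letting the conjugating matrix \<open>g\<close> run through \<open>O(3)\<close> lets \<open>g\<inverse> e3\<close> run through the whole
  unit sphere, because every unit vector is the image of \<open>e3\<close> under an orthogonal matrix.\<close>

lemma clips_O2_minus:
  assumes H: "H \<subseteq> O3"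
  shows "conj_class O2_minus \<circledcirc> conj_class H = {conj_class (stabilizer H v) | v. norm v = 1}"
proof -
  have conj_class_eq: "conj_class (O2_minus \<inter> conj_by g H) = conj_class (stabilizer H (transpose g *v e3))"
    if "g \<in> O3" for g
    using that H by (simp add: O2_minus_Int_conj_by conj_class_conj_by)
  have unit: "norm (transpose g *v e3) = 1" if "g \<in> O3" for g
  proof -
    have "orthogonal_transformation ((*v) (transpose g))"
      using O3_closed(3)[OF that] by (simp add: O3_def orthogonal_transformation_matrix)
    then show ?thesis
      by (simp add: orthogonal_transformation_norm del: transpose_matrix_vector)
  qed
  have transitive: "\<exists>g\<in>O3. v = transpose g *v e3" if "norm v = 1" for v
  proof -
    obtain A where "orthogonal_matrix A" "A *v e3 = v"
      using orthogonal_matrix_exists_basis[OF \<open>norm v = 1\<close>] by blast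
    then show ?thesis
      by (intro bexI[of _ "transpose A"]) (auto simp: O3_def)
  qed
  show ?thesis
    unfolding clips_conj_class
  proof (intro subset_antisym subsetI)
    fix C assume "C \<in> {conj_class (O2_minus \<inter> conj_by g H) | g. g \<in> O3}"
    then show "C \<in> {conj_class (stabilizer H v) | v. norm v = 1}"
      using conj_class_eq unit by blast
  next
    fix C assume "C \<in> {conj_class (stabilizer H v) | v. norm v = 1}"
    then obtain v where "C = conj_class (stabilizer H v)" "norm v = 1" by blast
    with transitive[of v] conj_class_eq show "C \<in> {conj_class (O2_minus \<inter> conj_by g H) | g. g \<in> O3}"
      by fastforce
  qed
qed

section \<open>Stabilizers in \<open>\<int>\<^sub>m \<oplus> \<int>\<^sub>2\<^sup>c\<close>\<close>

text \<open>A vector off the axis has a nonzero horizontal part \<open>w\<close>, and the inner product of \<open>w\<close> with its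
  rotated image is \<open>cos \<theta> |w|\<^sup>2\<close>.  So if the vector is fixed by the rotation or by its negative, then
  \<open>cos \<theta>\<close> is \<open>1\<close> or \<open>-1\<close>, respectively.\<close>

lemma rot_e3_fixes_iff:
  assumes "v $ 1 \<noteq> 0 \<or> v $ 2 \<noteq> 0"
  shows "rot e3 t *v v = v \<longleftrightarrow> cos t = 1"
proof
  assume "rot e3 t *v v = v"
  then have "cos t * v $ 1 - sin t * v $ 2 = v $ 1" "sin t * v $ 1 + cos t * v $ 2 = v $ 2"
    by (metis rot_e3_mult_vec)+
  then have "v $ 1 * (cos t * v $ 1 - sin t * v $ 2) + v $ 2 * (sin t * v $ 1 + cos t * v $ 2)
      = (v $ 1)\<^sup>2 + (v $ 2)\<^sup>2"
    by (simp add: power2_eq_square)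
  then have "(cos t - 1) * ((v $ 1)\<^sup>2 + (v $ 2)\<^sup>2) = 0"
    by (simp add: power2_eq_square algebra_simps)
  with assms show "cos t = 1" by (auto simp: sum_power2_eq_zero_iff)
next
  assume "cos t = 1"
  then show "rot e3 t *v v = v"
    using sin_cos_squared_add[of t] by (simp add: vec_eq_iff forall_3 rot_e3_mult_vec)
qed

lemma uminus_rot_e3_fixes_iff:
  assumes "v $ 1 \<noteq> 0 \<or> v $ 2 \<noteq> 0"
  shows "(- rot e3 t) *v v = v \<longleftrightarrow> v $ 3 = 0 \<and> cos t = -1"
proof
  assume "(- rot e3 t) *v v = v"
  then have "- (rot e3 t *v v) = v" by (simp add: matrix_vector_mult_uminus)
  then have "- (cos t * v $ 1 - sin t * v $ 2) = v $ 1" "- (sin t * v $ 1 + cos t * v $ 2) = v $ 2"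
    and "- (v $ 3) = v $ 3"
    by (metis rot_e3_mult_vec vector_uminus_component)+
  then have "v $ 1 * (- (cos t * v $ 1 - sin t * v $ 2)) + v $ 2 * (- (sin t * v $ 1 + cos t * v $ 2))
      = (v $ 1)\<^sup>2 + (v $ 2)\<^sup>2"
    by (simp only: power2_eq_square)
  then have "(cos t + 1) * ((v $ 1)\<^sup>2 + (v $ 2)\<^sup>2) = 0"
    by (simp add: power2_eq_square algebra_simps)
  with assms \<open>- (v $ 3) = v $ 3\<close> show "v $ 3 = 0 \<and> cos t = -1"
    by (auto simp: sum_power2_eq_zero_iff)
next
  assume "v $ 3 = 0 \<and> cos t = -1"
  then show "(- rot e3 t) *v v = v"
    using sin_cos_squared_add[of t]
    by (simp add: vec_eq_iff forall_3 rot_e3_mult_vec matrix_vector_mult_uminus)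
qed

lemma cos_Z_grp_angle_eq_1_iff:
  assumes "j < m"
  shows "cos (2 * real j * pi / real m) = 1 \<longleftrightarrow> j = 0"
proof
  assume "cos (2 * real j * pi / real m) = 1"
  then obtain k :: int where "2 * real j * pi / real m = of_int k * 2 * pi"
    unfolding cos_one_2pi_int by blast
  then have "real j = of_int k * real m"
    using assms by (simp add: field_simps)
  then have "int j = k * int m"
    by (metis of_int_eq_iff of_int_mult of_int_of_nat_eq)
  then have "m dvd j" by (metis dvd_triv_right int_dvd_int_iff)
  with assms show "j = 0" by (meson dvd_imp_le gr0I not_le)
qed simp

lemma cos_Z_grp_angle_eq_minus_1_iff:
  assumes "j < m"
  shows "cos (2 * real j * pi / real m) = -1 \<longleftrightarrow> m = 2 * j"
proof
  assume minus_one: "cos (2 * real j * pi / real m) = -1"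
  \<comment> \<open>The angle differs from \<open>\<pi>\<close> by a multiple \<open>2k\<pi>\<close>, and \<open>0 \<le> j < m\<close> leaves only \<open>k = 0\<close>.\<close>
  have "cos (2 * real j * pi / real m - pi) = 1"
    using minus_one by (simp add: cos_diff)
  then obtain k :: int where "2 * real j * pi / real m - pi = of_int k * 2 * pi"
    unfolding cos_one_2pi_int by blast
  then have "pi * (2 * real j) = pi * ((2 * of_int k + 1) * real m)"
    using assms by (simp add: field_simps)
  then have "2 * real j = (2 * of_int k + 1) * real m"
    by (simp only: mult_cancel_left pi_neq_zero simp_thms)
  then have "real_of_int (2 * int j) = real_of_int ((2 * k + 1) * int m)" by simp
  then have eq: "2 * int j = (2 * k + 1) * int m" by (simp only: of_int_eq_iff)
  have "k = 0"
  proof (rule ccontr)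
    assume "k \<noteq> 0"
    then consider "2 * k + 1 \<ge> 2" | "2 * k + 1 \<le> -1" by linarith
    then show False
    proof cases
      case 1
      then have "2 * int m \<le> (2 * k + 1) * int m" by (intro mult_right_mono) auto
      with eq assms show False by linarith
    next
      case 2
      then have "(2 * k + 1) * int m \<le> -1 * int m" by (intro mult_right_mono) auto
      with eq assms show False by linarith
    qed
  qed
  with eq show "m = 2 * j" by simp
next
  assume "m = 2 * j"
  with assms have "2 * real j * pi / real m = pi" by (simp add: field_simps)
  then show "cos (2 * real j * pi / real m) = -1" by simp
qed

lemma stabilizer_pole:
  assumes "v $ 1 = 0" "v $ 2 = 0" "v $ 3 \<noteq> 0"
  shows "stabilizer (plus_Z2c (Z_grp m)) v = Z_grp m"
proof -
  have "rot e3 t *v v = v" for t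
    using assms by (simp add: vec_eq_iff forall_3 rot_e3_mult_vec)
  moreover have "- v \<noteq> v"
    using assms(3) by (auto simp: vec_eq_iff)
  ultimately show ?thesis
    by (auto simp: stabilizer_def plus_Z2c_def Z_grp_def matrix_vector_mult_uminus)
qed

lemma stabilizer_off_axis:
  assumes m: "m > 0" and v: "v $ 1 \<noteq> 0 \<or> v $ 2 \<noteq> 0"
  shows "stabilizer (plus_Z2c (Z_grp m)) v
    = (if v $ 3 = 0 \<and> even m then Z2_minus else trivial_grp)"
proof -
  let ?t = "\<lambda>j. 2 * real j * pi / real m"
  have "stabilizer (plus_Z2c (Z_grp m)) v
      = {rot e3 (?t j) | j. j < m \<and> rot e3 (?t j) *v v = v}
        \<union> {- rot e3 (?t j) | j. j < m \<and> (- rot e3 (?t j)) *v v = v}"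
    by (auto simp: stabilizer_def plus_Z2c_def Z_grp_def)
  also have "{rot e3 (?t j) | j. j < m \<and> rot e3 (?t j) *v v = v} = {rot e3 (?t j) | j. j < m \<and> j = 0}"
    using rot_e3_fixes_iff[OF v] cos_Z_grp_angle_eq_1_iff by blast
  also have "\<dots> = {mat 1}" using m by (simp add: rot_e3_0)
  also have "{- rot e3 (?t j) | j. j < m \<and> (- rot e3 (?t j)) *v v = v}
      = {- rot e3 (?t j) | j. v $ 3 = 0 \<and> j < m \<and> m = 2 * j}"
    using uminus_rot_e3_fixes_iff[OF v] cos_Z_grp_angle_eq_minus_1_iff by blast
  also have "\<dots> = (if v $ 3 = 0 \<and> even m then {- rot e3 pi} else {})"
    using m by (auto simp: field_simps elim!: evenE)
  finally show ?thesis by (auto simp: Z2_minus_def trivial_grp_def)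
qed

lemma Z_minus_gcd_2: "Z_minus (gcd 2 m) = (if even m then Z2_minus else trivial_grp)"
proof (cases "even m")
  case True
  then have "gcd 2 m = 2" by (simp add: gcd_nat.absorb1)
  with True show ?thesis by (simp add: Z_minus_def)
next
  case False
  then have "gcd 2 m = 1" by (simp add: coprime_iff_gcd_eq_1[symmetric])
  with False show ?thesis by (simp add: Z_minus_def)
qed

section \<open>The clips operation\<close>

theorem lemma4p26:
  fixes m :: nat
  assumes "m \<ge> 2"
  shows "conj_class O2_minus \<circledcirc> conj_class (plus_Z2c (Z_grp m)) =
    {conj_class trivial_grp, conj_class (Z_grp m), conj_class (Z_minus (gcd 2 m))}"
proof -
  let ?S = "stabilizer (plus_Z2c (Z_grp m))"
  have "m > 0" using assms by simp
  note off_axis = stabilizer_off_axis[OF this]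
  have stabilizers: "?S v \<in> {trivial_grp, Z_grp m, Z_minus (gcd 2 m)}" if "norm v = 1" for v
  proof (cases "v $ 1 = 0 \<and> v $ 2 = 0")
    case True
    moreover have "v \<noteq> 0" using that by auto
    ultimately have "v $ 3 \<noteq> 0" by (auto simp: vec_eq_iff forall_3)
    with True show ?thesis by (simp add: stabilizer_pole)
  next
    case False
    then show ?thesis by (auto simp: off_axis Z_minus_gcd_2)
  qed
  have pole: "norm e3 = 1" "?S e3 = Z_grp m"
    by (simp_all add: stabilizer_pole axis_def norm_vec_def L2_set_def sum_3)
  have equator: "norm e1 = 1" "?S e1 = Z_minus (gcd 2 m)"
    by (simp_all add: off_axis Z_minus_gcd_2 axis_def norm_vec_def L2_set_def sum_3)
  \<comment> \<open>A unit vector that is neither vertical nor horizontal; the triple \<open>3, 4, 5\<close> keeps it rational.\<close>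
  define w :: "real^3" where "w = vector [3/5, 0, 4/5]"
  have oblique: "norm w = 1" "?S w = trivial_grp"
    by (simp_all add: w_def off_axis norm_vec_def L2_set_def sum_3 power2_eq_square)
  have "?S ` {v. norm v = 1} = {trivial_grp, Z_grp m, Z_minus (gcd 2 m)}"
  proof (rule subset_antisym)
    show "?S ` {v. norm v = 1} \<subseteq> {trivial_grp, Z_grp m, Z_minus (gcd 2 m)}"
      using stabilizers by blast
    have "{?S w, ?S e3, ?S e1} \<subseteq> ?S ` {v. norm v = 1}"
      using pole(1) equator(1) oblique(1) by blast
    then show "{trivial_grp, Z_grp m, Z_minus (gcd 2 m)} \<subseteq> ?S ` {v. norm v = 1}"
      by (simp only: pole(2) equator(2) oblique(2))
  qed
  then have "conj_class ` ?S ` {v. norm v = 1}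
      = {conj_class trivial_grp, conj_class (Z_grp m), conj_class (Z_minus (gcd 2 m))}"
    by (simp only: image_insert image_empty)
  moreover have "conj_class ` ?S ` {v. norm v = 1} = {conj_class (?S v) | v. norm v = 1}"
    by blast
  ultimately show ?thesis
    by (simp only: clips_O2_minus[OF plus_Z2c_Z_grp_subset_O3])
qed

end
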